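(* Let $(E,\langle\cdot,\cdot\rangle,\Theta)$ be a Courant algebroid and let $I$ be a skew-symmetric $(1,1)$-tensor on $E$. If $I$ is Nijenhuis for $\Theta$, then the Courant structures $\Theta_k$ and $\Theta_m$ on $(E,\langle\cdot,\cdot\rangle)$ are compatible, for all $k,m\in\mathbb{N}$. In particular, $\Theta$ is compatible with $\Theta_k$ for all $k\in\mathbb{N}$.
   Context: $E\to M$ is a real vector bundle over a smooth manifold with a fibrewise non-degenerate symmetric bilinear form $\langle\cdot,\cdot\rangle$. A pre-Courant structure $\Theta$ on $(E,\langle\cdot,\cdot\rangle)$ is a pair $(\rho,[\cdot,\cdot])$, where $\rho:E\to TM$ is a bundle map (anchor) and $[\cdot,\cdot]$ is an $\mathbb{R}$-bilinear, not necessarily skew-symmetric, bracket on $\Gamma(E)$ (Dorfman bracket) such that, for all $X,Y,Z\in\Gamma(E)$, $\rho(X)\cdot\langle Y,Z\rangle=\langle[X,Y],Z\rangle+\langle Y,[X,Z]\rangle$ and $\rho(X)\cdot\langle Y,Z\rangle=\langle X,[Y,Z]+[Z,Y]\rangle$. It is a Courant structure if moreover $[X,[Y,Z]]=[[X,Y],Z]+[Y,[X,Z]]$ for all $X,Y,Z$; then $(E,\langle\cdot,\cdot\rangle,\Theta)$ is a Courant algebroid. Sums of (pre-)Courant structures are taken componentwise. A $(1,1)$-tensor is a vector bundle endomorphism of $E$ over $\mathrm{id}_M$; $I$ is skew-symmetric if $\langle Iu,v\rangle+\langle u,Iv\rangle=0$. For $I$ skew-symmetric, the deformation of $\Theta$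 by $I$ is the pre-Courant structure $\Theta_I=(\rho\circ I,[\cdot,\cdot]_I)$ with $[X,Y]_I=[IX,Y]+[X,IY]-I[X,Y]$. $\Theta_k$ is the structure obtained by deforming $\Theta$ successively $k$ times by $I$, i.e. $\Theta_0=\Theta$, $\Theta_{k}=(\Theta_{k-1})_I$. $\mathbb{N}$ includes $0$. $I$ is Nijenhuis for $\Theta$ if $[IX,IY]-I([X,Y]_I)=0$ for all $X,Y\in\Gamma(E)$. Two Courant structures on $(E,\langle\cdot,\cdot\rangle)$ are compatible if their sum is a Courant structure on $(E,\langle\cdot,\cdot\rangle)$. (Under these hypotheses each $\Theta_k$ is a Courant structure.) *)

theory Defs
  imports "HOL-Analysis.Analysis"
begin

section \<open>Smooth functions on open subsets of Euclidean space\<close>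

text \<open>
  The library's \<^term>\<open>Euclidean_space n\<close> is the set of all \<open>x :: nat \<Rightarrow> real\<close> with
  \<open>x i = 0\<close> for \<open>i \<ge> n\<close>, so the dimension is an arbitrary natural number, \<open>0\<close> included.
\<close>

definition partial_deriv :: "nat \<Rightarrow> ((nat \<Rightarrow> real) \<Rightarrow> real) \<Rightarrow> (nat \<Rightarrow> real) \<Rightarrow> real" where
  "partial_deriv i f x = deriv (\<lambda>t. f (x(i := t))) (x i)"

primrec Ck_on :: "nat \<Rightarrow> nat \<Rightarrow> (nat \<Rightarrow> real) set \<Rightarrow> ((nat \<Rightarrow> real) \<Rightarrow> real) \<Rightarrow> bool" where
  "Ck_on 0 n V f \<longleftrightarrow> continuous_map (subtopology (Euclidean_space n) V) euclideanreal f"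
| "Ck_on (Suc k) n V f \<longleftrightarrow>
     continuous_map (subtopology (Euclidean_space n) V) euclideanreal f \<and>
     (\<forall>i<n. (\<forall>x\<in>V. (\<lambda>t. f (x(i := t))) differentiable at (x i)) \<and>
            Ck_on k n V (partial_deriv i f))"

definition smooth_on :: "nat \<Rightarrow> (nat \<Rightarrow> real) set \<Rightarrow> ((nat \<Rightarrow> real) \<Rightarrow> real) \<Rightarrow> bool" where
  "smooth_on n V f \<longleftrightarrow> (\<forall>k. Ck_on k n V f)"


section \<open>Smooth manifolds\<close>

text \<open>
  A chart is a pair \<open>(U, \<phi>)\<close> of a domain and a coordinate map, of which only the restriction
  to \<open>U\<close> matters. The atlas is not required to be maximal.
\<close>

record 'm manifold =
  mtop :: "'m topology"
  mdim :: nat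
  atlas :: "('m set \<times> ('m \<Rightarrow> nat \<Rightarrow> real)) set"

abbreviation points :: "'m manifold \<Rightarrow> 'm set" where
  "points M \<equiv> topspace (mtop M)"

definition smooth_manifold :: "'m manifold \<Rightarrow> bool" where
  "smooth_manifold M \<longleftrightarrow>
     Hausdorff_space (mtop M) \<and> second_countable (mtop M) \<and>
     (\<forall>(U, \<phi>)\<in>atlas M.
        openin (mtop M) U \<and> openin (Euclidean_space (mdim M)) (\<phi> ` U) \<and>
        homeomorphic_map (subtopology (mtop M) U)
          (subtopology (Euclidean_space (mdim M)) (\<phi> ` U)) \<phi>) \<and>
     (\<forall>p\<in>points M. \<exists>(U, \<phi>)\<in>atlas M. p \<in> U) \<and>
     (\<forall>(U, \<phi>)\<in>atlas M. \<forall>(V, \<psi>)\<in>atlas M. \<forall>j<mdim M.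
        smooth_on (mdim M) (\<phi> ` (U \<inter> V)) (\<lambda>x. \<psi> (inv_into U \<phi> x) j))"

text \<open>Smoothness of a function on an open subset \<open>W\<close> of the manifold.\<close>

definition smooth_fun_on :: "'m manifold \<Rightarrow> 'm set \<Rightarrow> ('m \<Rightarrow> real) \<Rightarrow> bool" where
  "smooth_fun_on M W f \<longleftrightarrow>
     (\<forall>(U, \<phi>)\<in>atlas M. smooth_on (mdim M) (\<phi> ` (U \<inter> W)) (f \<circ> inv_into U \<phi>))"

text \<open>
  Objects defined on \<open>M\<close> are represented by total functions. For the global smooth functions, and
  below for the sections of a vector bundle, the value off \<open>M\<close> is fixed to be \<open>0\<close>, so that
  equality of representatives is equality on \<open>M\<close>.
\<close>

definition Cinf :: "'m manifold \<Rightarrow> ('m \<Rightarrow> real) set" where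
  "Cinf M = {f. smooth_fun_on M (points M) f \<and> (\<forall>p. p \<notin> points M \<longrightarrow> f p = 0)}"

text \<open>
  Tangent vectors at \<open>p\<close> are the derivations at \<open>p\<close> of the algebra of global smooth functions
  (extended by \<open>0\<close> to arguments that are not smooth functions).
\<close>

definition tangent_space :: "'m manifold \<Rightarrow> 'm \<Rightarrow> (('m \<Rightarrow> real) \<Rightarrow> real) set" where
  "tangent_space M p = {v.
     (\<forall>f\<in>Cinf M. \<forall>h\<in>Cinf M. \<forall>a b. v (\<lambda>q. a * f q + b * h q) = a * v f + b * v h) \<and>
     (\<forall>f\<in>Cinf M. \<forall>h\<in>Cinf M. v (\<lambda>q. f q * h q) = f p * v h + h p * v f) \<and>
     (\<forall>f. f \<notin> Cinf M \<longrightarrow> v f = 0)}"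

definition coord_vector ::
  "'m set \<times> ('m \<Rightarrow> nat \<Rightarrow> real) \<Rightarrow> nat \<Rightarrow> 'm \<Rightarrow> ('m \<Rightarrow> real) \<Rightarrow> real" where
  "coord_vector c i p f =
     partial_deriv i (f \<circ> inv_into (fst c) (snd c)) (snd c p)"


section \<open>Vector bundles\<close>

text \<open>
  The fibres are linear subspaces of one ambient real vector space, which carries no further
  meaning (for abstract fibres one can take their direct sum as ambient space). The smooth structure
  is given by a set of local frames \<open>(U, s)\<close> covering the base, where \<open>s 0, \<dots>, s (r - 1)\<close>
  restrict to a basis of each fibre over \<open>U\<close>; these are the same data as local
  trivializations, and the transition functions between them are required to be smooth.
\<close>

record ('m, 'v) vbundle =
  base :: "'m manifold"
  brank :: nat
  fibre :: "'m \<Rightarrow> 'v set"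
  frames :: "('m set \<times> (nat \<Rightarrow> 'm \<Rightarrow> 'v)) set"

text \<open>
  \<open>Y\<close> has smooth components over \<open>W\<close> (an open subset of the domain) in the local frame \<open>s\<close>.
\<close>

definition smooth_in_frame ::
  "('m, 'v::real_vector) vbundle \<Rightarrow> (nat \<Rightarrow> 'm \<Rightarrow> 'v) \<Rightarrow> 'm set \<Rightarrow> ('m \<Rightarrow> 'v) \<Rightarrow> bool" where
  "smooth_in_frame E s W Y \<longleftrightarrow>
     (\<exists>c. (\<forall>i<brank E. smooth_fun_on (base E) W (c i)) \<and>
          (\<forall>p\<in>W. Y p = (\<Sum>i<brank E. c i p *\<^sub>R s i p)))"

definition vector_bundle :: "('m, 'v::real_vector) vbundle \<Rightarrow> bool" where
  "vector_bundle E \<longleftrightarrow>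
     smooth_manifold (base E) \<and>
     (\<forall>p\<in>points (base E). subspace (fibre E p)) \<and>
     (\<forall>p\<in>points (base E). \<exists>(U, s)\<in>frames E. p \<in> U) \<and>
     (\<forall>(U, s)\<in>frames E. openin (mtop (base E)) U \<and>
        (\<forall>p\<in>U. inj_on (\<lambda>i. s i p) {..<brank E} \<and>
               independent ((\<lambda>i. s i p) ` {..<brank E}) \<and>
               span ((\<lambda>i. s i p) ` {..<brank E}) = fibre E p)) \<and>
     (\<forall>(U, s)\<in>frames E. \<forall>(V, t)\<in>frames E. \<forall>j<brank E.
        smooth_in_frame E s (U \<inter> V) (t j))"

definition sections :: "('m, 'v::real_vector) vbundle \<Rightarrow> ('m \<Rightarrow> 'v) set" where
  "sections E = {X.
     (\<forall>p\<in>points (base E). X p \<in> fibre E p) \<and>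
     (\<forall>p. p \<notin> points (base E) \<longrightarrow> X p = 0) \<and>
     (\<forall>(U, s)\<in>frames E. smooth_in_frame E s U X)}"

text \<open>Vector bundle endomorphisms over the identity.\<close>

definition tensor11 :: "('m, 'v::real_vector) vbundle \<Rightarrow> ('m \<Rightarrow> 'v \<Rightarrow> 'v) \<Rightarrow> bool" where
  "tensor11 E A \<longleftrightarrow>
     (\<forall>p\<in>points (base E). \<forall>u\<in>fibre E p. A p u \<in> fibre E p) \<and>
     (\<forall>p\<in>points (base E). \<forall>u\<in>fibre E p. \<forall>v\<in>fibre E p. \<forall>a b.
        A p (a *\<^sub>R u + b *\<^sub>R v) = a *\<^sub>R A p u + b *\<^sub>R A p v) \<and>
     (\<forall>(U, s)\<in>frames E. \<forall>(V, t)\<in>frames E. \<forall>j<brank E.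
        smooth_in_frame E t (U \<inter> V) (\<lambda>p. A p (s j p)))"

definition act :: "('m, 'v::real_vector) vbundle \<Rightarrow> ('m \<Rightarrow> 'v \<Rightarrow> 'v) \<Rightarrow> ('m \<Rightarrow> 'v) \<Rightarrow> 'm \<Rightarrow> 'v" where
  "act E A X = (\<lambda>p. if p \<in> points (base E) then A p (X p) else 0)"

text \<open>
  Vector bundle maps from \<open>E\<close> to the tangent bundle over the identity. Smoothness is expressed in
  the local frames of \<open>E\<close> and the coordinate frames of the tangent bundle.
\<close>

definition anchor_map ::
  "('m, 'v::real_vector) vbundle \<Rightarrow> ('m \<Rightarrow> 'v \<Rightarrow> ('m \<Rightarrow> real) \<Rightarrow> real) \<Rightarrow> bool" where
  "anchor_map E \<rho> \<longleftrightarrow>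
     (\<forall>p\<in>points (base E). \<forall>u\<in>fibre E p. \<rho> p u \<in> tangent_space (base E) p) \<and>
     (\<forall>p\<in>points (base E). \<forall>u\<in>fibre E p. \<forall>v\<in>fibre E p. \<forall>a b f.
        \<rho> p (a *\<^sub>R u + b *\<^sub>R v) f = a * \<rho> p u f + b * \<rho> p v f) \<and>
     (\<forall>(U, s)\<in>frames E. \<forall>(V, \<phi>)\<in>atlas (base E). \<forall>j<brank E.
        \<exists>c. (\<forall>i<mdim (base E). smooth_fun_on (base E) (U \<inter> V) (c i)) \<and>
            (\<forall>p\<in>U \<inter> V. \<forall>f\<in>Cinf (base E).
               \<rho> p (s j p) f = (\<Sum>i<mdim (base E). c i p * coord_vector (V, \<phi>) i p f)))"

definition fibre_form :: "('m, 'v::real_vector) vbundle \<Rightarrow> ('m \<Rightarrow> 'v \<Rightarrow> 'v \<Rightarrow> real) \<Rightarrow> bool" where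
  "fibre_form E g \<longleftrightarrow>
     (\<forall>p\<in>points (base E). \<forall>u\<in>fibre E p. \<forall>v\<in>fibre E p. \<forall>w\<in>fibre E p. \<forall>a b.
        g p (a *\<^sub>R u + b *\<^sub>R v) w = a * g p u w + b * g p v w) \<and>
     (\<forall>p\<in>points (base E). \<forall>u\<in>fibre E p. \<forall>v\<in>fibre E p. g p u v = g p v u) \<and>
     (\<forall>p\<in>points (base E). \<forall>u\<in>fibre E p. (\<forall>v\<in>fibre E p. g p u v = 0) \<longrightarrow> u = 0) \<and>
     (\<forall>(U, s)\<in>frames E. \<forall>i<brank E. \<forall>j<brank E.
        smooth_fun_on (base E) U (\<lambda>p. g p (s i p) (s j p)))"

definition pairing ::
  "('m, 'v::real_vector) vbundle \<Rightarrow> ('m \<Rightarrow> 'v \<Rightarrow> 'v \<Rightarrow> real) \<Rightarrow> ('m \<Rightarrow> 'v) \<Rightarrow> ('m \<Rightarrow> 'v) \<Rightarrow> 'm \<Rightarrow> real"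
where
  "pairing E g Y Z = (\<lambda>p. if p \<in> points (base E) then g p (Y p) (Z p) else 0)"

definition skew_symmetric ::
  "('m, 'v::real_vector) vbundle \<Rightarrow> ('m \<Rightarrow> 'v \<Rightarrow> 'v \<Rightarrow> real) \<Rightarrow> ('m \<Rightarrow> 'v \<Rightarrow> 'v) \<Rightarrow> bool" where
  "skew_symmetric E g A \<longleftrightarrow>
     (\<forall>p\<in>points (base E). \<forall>u\<in>fibre E p. \<forall>v\<in>fibre E p. g p (A p u) v + g p u (A p v) = 0)"


section \<open>Courant structures\<close>

text \<open>The bracket is meaningful on sections only.\<close>

record ('m, 'v) anchored_bracket =
  anchor :: "'m \<Rightarrow> 'v \<Rightarrow> ('m \<Rightarrow> real) \<Rightarrow> real"
  dorfman :: "('m \<Rightarrow> 'v) \<Rightarrow> ('m \<Rightarrow> 'v) \<Rightarrow> 'm \<Rightarrow> 'v"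

definition pre_courant ::
  "('m, 'v::real_vector) vbundle \<Rightarrow> ('m \<Rightarrow> 'v \<Rightarrow> 'v \<Rightarrow> real) \<Rightarrow> ('m, 'v) anchored_bracket \<Rightarrow> bool" where
  "pre_courant E g \<Theta> \<longleftrightarrow>
     anchor_map E (anchor \<Theta>) \<and>
     (\<forall>X\<in>sections E. \<forall>Y\<in>sections E. dorfman \<Theta> X Y \<in> sections E) \<and>
     (\<forall>X\<in>sections E. \<forall>Y\<in>sections E. \<forall>Z\<in>sections E. \<forall>a b. \<forall>p\<in>points (base E).
        dorfman \<Theta> (\<lambda>q. a *\<^sub>R X q + b *\<^sub>R Y q) Z p
          = a *\<^sub>R dorfman \<Theta> X Z p + b *\<^sub>R dorfman \<Theta> Y Z p \<and>
        dorfman \<Theta> Z (\<lambda>q. a *\<^sub>R X q + b *\<^sub>R Y q) p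
          = a *\<^sub>R dorfman \<Theta> Z X p + b *\<^sub>R dorfman \<Theta> Z Y p) \<and>
     (\<forall>X\<in>sections E. \<forall>Y\<in>sections E. \<forall>Z\<in>sections E. \<forall>p\<in>points (base E).
        anchor \<Theta> p (X p) (pairing E g Y Z)
          = g p (dorfman \<Theta> X Y p) (Z p) + g p (Y p) (dorfman \<Theta> X Z p) \<and>
        anchor \<Theta> p (X p) (pairing E g Y Z)
          = g p (X p) (dorfman \<Theta> Y Z p + dorfman \<Theta> Z Y p))"

definition courant ::
  "('m, 'v::real_vector) vbundle \<Rightarrow> ('m \<Rightarrow> 'v \<Rightarrow> 'v \<Rightarrow> real) \<Rightarrow> ('m, 'v) anchored_bracket \<Rightarrow> bool" where
  "courant E g \<Theta> \<longleftrightarrow>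
     pre_courant E g \<Theta> \<and>
     (\<forall>X\<in>sections E. \<forall>Y\<in>sections E. \<forall>Z\<in>sections E. \<forall>p\<in>points (base E).
        dorfman \<Theta> X (dorfman \<Theta> Y Z) p
          = dorfman \<Theta> (dorfman \<Theta> X Y) Z p + dorfman \<Theta> Y (dorfman \<Theta> X Z) p)"

definition courant_algebroid ::
  "('m, 'v::real_vector) vbundle \<Rightarrow> ('m \<Rightarrow> 'v \<Rightarrow> 'v \<Rightarrow> real) \<Rightarrow> ('m, 'v) anchored_bracket \<Rightarrow> bool" where
  "courant_algebroid E g \<Theta> \<longleftrightarrow> vector_bundle E \<and> fibre_form E g \<and> courant E g \<Theta>"

definition structure_sum ::
  "('m, 'v::real_vector) anchored_bracket \<Rightarrow> ('m, 'v) anchored_bracket \<Rightarrow> ('m, 'v) anchored_bracket"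
where
  "structure_sum \<Theta> \<Psi> =
     \<lparr> anchor = (\<lambda>p u f. anchor \<Theta> p u f + anchor \<Psi> p u f),
       dorfman = (\<lambda>X Y p. dorfman \<Theta> X Y p + dorfman \<Psi> X Y p) \<rparr>"

definition deform ::
  "('m, 'v::real_vector) vbundle \<Rightarrow> ('m \<Rightarrow> 'v \<Rightarrow> 'v) \<Rightarrow> ('m, 'v) anchored_bracket
     \<Rightarrow> ('m, 'v) anchored_bracket" where
  "deform E A \<Theta> =
     \<lparr> anchor = (\<lambda>p u. anchor \<Theta> p (A p u)),
       dorfman = (\<lambda>X Y p. dorfman \<Theta> (act E A X) Y p + dorfman \<Theta> X (act E A Y) p
                            - act E A (dorfman \<Theta> X Y) p) \<rparr>"

primrec deform_iter ::
  "('m, 'v::real_vector) vbundle \<Rightarrow> ('m \<Rightarrow> 'v \<Rightarrow> 'v) \<Rightarrow> ('m, 'v) anchored_bracket \<Rightarrow> nat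
     \<Rightarrow> ('m, 'v) anchored_bracket" where
  "deform_iter E A \<Theta> 0 = \<Theta>"
| "deform_iter E A \<Theta> (Suc k) = deform E A (deform_iter E A \<Theta> k)"

definition nijenhuis ::
  "('m, 'v::real_vector) vbundle \<Rightarrow> ('m, 'v) anchored_bracket \<Rightarrow> ('m \<Rightarrow> 'v \<Rightarrow> 'v) \<Rightarrow> bool" where
  "nijenhuis E \<Theta> A \<longleftrightarrow>
     (\<forall>X\<in>sections E. \<forall>Y\<in>sections E. \<forall>p\<in>points (base E).
        dorfman \<Theta> (act E A X) (act E A Y) p - act E A (dorfman (deform E A \<Theta>) X Y) p = 0)"

text \<open>Compatibility is a relation between Courant structures.\<close>

definition compatible ::
  "('m, 'v::real_vector) vbundle \<Rightarrow> ('m \<Rightarrow> 'v \<Rightarrow> 'v \<Rightarrow> real) \<Rightarrow> ('m, 'v) anchored_bracket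
     \<Rightarrow> ('m, 'v) anchored_bracket \<Rightarrow> bool" where
  "compatible E g \<Theta> \<Psi> \<longleftrightarrow>
     courant E g \<Theta> \<and> courant E g \<Psi> \<and> courant E g (structure_sum \<Theta> \<Psi>)"

end

theory Submission
  imports Defs "HOL-Library.Function_Algebras"
begin

text \<open>
  Write \<open>\<mu>\<^sub>k\<close> for the bracket of \<open>\<Theta>\<^sub>k\<close> and \<open>C(\<mu>, \<nu>)\<close> for the polarization of the Leibniz
  identity, so that two Leibniz brackets have a Leibniz sum iff \<open>C(\<mu>, \<nu>) = 0\<close>. Deformation by
  \<open>I\<close> acts on multilinear maps as a derivation, so \<open>C(\<mu>\<^sub>k, \<mu>\<^sub>m) = 0\<close> implies
  \<open>C(\<mu>\<^bsub>k+1\<^esub>, \<mu>\<^sub>m) + C(\<mu>\<^sub>k, \<mu>\<^bsub>m+1\<^esub>) = 0\<close>. The Nijenhuis condition makes \<open>\<mu>\<^sub>1\<close> a Leibniz bracket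
  for which \<open>I\<close> is again Nijenhuis, so every \<open>\<mu>\<^sub>k\<close> is Leibniz; the vanishing of
  \<open>C(\<mu>\<^sub>k, \<mu>\<^bsub>k+n\<^esub>)\<close> then follows by induction on \<open>n\<close>, simultaneously for all \<open>k\<close>.
  Skew-symmetry of \<open>I\<close> only serves to preserve the two metric axioms of a pre-Courant structure.
\<close>

section \<open>Smooth functions\<close>

lemma openin_coordinate_line:
  assumes "openin (Euclidean_space n) V" "x \<in> V" "i < n"
  shows "eventually (\<lambda>t. x(i := t) \<in> V) (nhds (x i))"
proof -
  have x: "x \<in> topspace (Euclidean_space n)"
    using assms openin_subset by blast
  \<comment> \<open>As \<open>i < n\<close>, changing coordinate \<open>i\<close> leaves the
    coordinates from \<open>n\<close> on at 0, so the line stays in the space.\<close>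
  have "continuous_map euclideanreal (Euclidean_space n) (\<lambda>t. x(i := t))"
    using x assms(3)
    by (auto simp: Euclidean_space_def continuous_map_in_subtopology
        continuous_map_componentwise_UNIV fun_upd_def)
  from openin_continuous_map_preimage[OF this assms(1)]
  have "open {t. x(i := t) \<in> V}" by simp
  then show ?thesis
    using assms(2) by (subst eventually_nhds) (auto intro!: exI[of _ "{t. x(i := t) \<in> V}"])
qed

lemma partial_deriv_cong:
  assumes "openin (Euclidean_space n) V" "x \<in> V" "i < n" "\<And>y. y \<in> V \<Longrightarrow> f y = h y"
  shows "partial_deriv i f x = partial_deriv i h x"
  unfolding partial_deriv_def
  by (intro deriv_cong_ev refl eventually_mono[OF openin_coordinate_line[OF assms(1-3)]] assms(4))

text \<open>A partial derivative at a point of the open set \<open>V\<close> depends only on values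
  in \<open>V\<close>. This makes the rules of differentiation usable, since they identify functions
  on \<open>V\<close> only.\<close>

lemma Ck_on_cong:
  assumes "openin (Euclidean_space n) V" "\<And>y. y \<in> V \<Longrightarrow> f y = h y" "Ck_on k n V f"
  shows "Ck_on k n V h"
  using assms(2,3)
proof (induction k arbitrary: f h)
  case 0
  then show ?case
    by (auto elim!: continuous_map_eq)
next
  case (Suc k)
  have "(\<lambda>t. h (x(i := t))) differentiable at (x i)" if "i < n" "x \<in> V" for i x
  proof -
    have "(\<lambda>t. f (x(i := t))) differentiable at (x i)" using Suc.prems that by simp
    then obtain D where "((\<lambda>t. f (x(i := t))) has_real_derivative D) (at (x i))"
      by (auto simp: real_differentiable_def)
    moreover have "eventually (\<lambda>t. f (x(i := t)) = h (x(i := t))) (nhds (x i))"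
      by (intro eventually_mono[OF openin_coordinate_line[OF assms(1) that(2,1)]] Suc.prems(1))
    ultimately have "((\<lambda>t. h (x(i := t))) has_real_derivative D) (at (x i))"
      by (subst (asm) DERIV_cong_ev) auto
    then show ?thesis by (auto simp: real_differentiable_def)
  qed
  moreover have "Ck_on k n V (partial_deriv i h)" if "i < n" for i
    using Suc.IH[of "partial_deriv i f" "partial_deriv i h"] Suc.prems that
      partial_deriv_cong[OF assms(1) _ that, of _ f h] by auto
  moreover have "continuous_map (subtopology (Euclidean_space n) V) euclideanreal h"
    using Suc.prems by (auto elim!: continuous_map_eq)
  ultimately show ?case by simp
qed

lemma Ck_on_Suc_imp: "Ck_on (Suc k) n V f \<Longrightarrow> Ck_on k n V f"
  by (induction k arbitrary: f) auto

lemma Ck_on_subset: "Ck_on k n V f \<Longrightarrow> W \<subseteq> V \<Longrightarrow> Ck_on k n W f"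
  by (induction k arbitrary: f) (auto intro: continuous_map_from_subtopology_mono)

lemma Ck_on_const: "Ck_on k n V (\<lambda>x. c)"
proof (induction k arbitrary: c)
  case (Suc k)
  moreover have "partial_deriv i (\<lambda>x. c) = (\<lambda>x. 0)" for i
    by (auto simp: partial_deriv_def)
  ultimately show ?case by simp
qed simp

lemma Ck_on_add:
  assumes "openin (Euclidean_space n) V" "Ck_on k n V f" "Ck_on k n V h"
  shows "Ck_on k n V (\<lambda>x. f x + h x)"
  using assms(2,3)
proof (induction k arbitrary: f h)
  case (Suc k)
  have "Ck_on k n V (partial_deriv i (\<lambda>x. f x + h x))" if "i < n" for i
  proof (rule Ck_on_cong[OF assms(1)])
    show "Ck_on k n V (\<lambda>x. partial_deriv i f x + partial_deriv i h x)"
      using Suc that by simp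
    show "partial_deriv i f x + partial_deriv i h x = partial_deriv i (\<lambda>x. f x + h x) x"
      if "x \<in> V" for x
      using Suc.prems \<open>i < n\<close> that
      by (simp add: partial_deriv_def field_differentiable_def real_differentiable_def)
  qed
  then show ?case
    using Suc.prems by (auto intro: continuous_map_add)
qed (auto intro: continuous_map_add)

text \<open>The product rule expresses the derivative through \<open>f\<close> and \<open>h\<close>
  themselves, which are therefore lowered to order \<open>k\<close> by \<open>Ck_on_Suc_imp\<close>
  before the induction hypothesis applies.\<close>

lemma Ck_on_mult:
  assumes "openin (Euclidean_space n) V" "Ck_on k n V f" "Ck_on k n V h"
  shows "Ck_on k n V (\<lambda>x. f x * h x)"
  using assms(2,3)
proof (induction k arbitrary: f h)
  case (Suc k)
  have "Ck_on k n V (partial_deriv i (\<lambda>x. f x * h x))" if "i < n" for i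
  proof (rule Ck_on_cong[OF assms(1)])
    show "Ck_on k n V (\<lambda>x. f x * partial_deriv i h x + partial_deriv i f x * h x)"
      using Suc that Ck_on_Suc_imp[OF Suc.prems(1)] Ck_on_Suc_imp[OF Suc.prems(2)]
      by (intro Ck_on_add[OF assms(1)]) auto
    show "f x * partial_deriv i h x + partial_deriv i f x * h x
        = partial_deriv i (\<lambda>x. f x * h x) x" if "x \<in> V" for x
      using Suc.prems \<open>i < n\<close> that
      by (simp add: partial_deriv_def field_differentiable_def real_differentiable_def)
  qed
  then show ?case
    using Suc.prems by (auto intro: continuous_map_real_mult)
qed (auto intro: continuous_map_real_mult)

text \<open>A chart is open onto its image, and that image is open in Euclidean space. This supplies
  the open domains on which \<open>Ck_on\<close> is closed under sums and products.\<close>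

lemma openin_chart_image:
  assumes "smooth_manifold M" "(U, \<phi>) \<in> atlas M" "openin (mtop M) W"
  shows "openin (Euclidean_space (mdim M)) (\<phi> ` (U \<inter> W))"
proof -
  have U: "openin (Euclidean_space (mdim M)) (\<phi> ` U)"
    and hom: "homeomorphic_map (subtopology (mtop M) U)
          (subtopology (Euclidean_space (mdim M)) (\<phi> ` U)) \<phi>"
    using assms(1,2) unfolding smooth_manifold_def by blast+
  have "openin (subtopology (mtop M) U) (U \<inter> W)"
    using assms(3) by (simp add: openin_subtopology_Int2)
  then have "openin (subtopology (Euclidean_space (mdim M)) (\<phi> ` U)) (\<phi> ` (U \<inter> W))"
    using hom homeomorphic_imp_open_map open_map_def by blast
  then show ?thesis
    using U openin_trans_full by blast
qed

section \<open>The ring of smooth functions on an open subset of the manifold\<close>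

lemma smooth_fun_on_const: "smooth_fun_on M W (\<lambda>p. c)"
  by (auto simp: smooth_fun_on_def smooth_on_def o_def Ck_on_const)

lemma smooth_fun_on_subset: "smooth_fun_on M W f \<Longrightarrow> W' \<subseteq> W \<Longrightarrow> smooth_fun_on M W' f"
  unfolding smooth_fun_on_def smooth_on_def by (fast intro: Ck_on_subset)

lemma smooth_fun_on_add:
  assumes "smooth_manifold M" "openin (mtop M) W" "smooth_fun_on M W f" "smooth_fun_on M W h"
  shows "smooth_fun_on M W (\<lambda>p. f p + h p)"
  using assms(3,4) openin_chart_image[OF assms(1) _ assms(2)]
  unfolding smooth_fun_on_def smooth_on_def o_def by (fast intro: Ck_on_add)

lemma smooth_fun_on_mult:
  assumes "smooth_manifold M" "openin (mtop M) W" "smooth_fun_on M W f" "smooth_fun_on M W h"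
  shows "smooth_fun_on M W (\<lambda>p. f p * h p)"
  using assms(3,4) openin_chart_image[OF assms(1) _ assms(2)]
  unfolding smooth_fun_on_def smooth_on_def o_def by (fast intro: Ck_on_mult)

lemma smooth_fun_on_sum:
  assumes "smooth_manifold M" "openin (mtop M) W" "\<And>i. i \<in> A \<Longrightarrow> smooth_fun_on M W (f i)"
  shows "smooth_fun_on M W (\<lambda>p. \<Sum>i\<in>A. f i p)"
  using assms(3)
  by (induction A rule: infinite_finite_induct)
    (auto intro: smooth_fun_on_const smooth_fun_on_add[OF assms(1,2)])

section \<open>Sections, endomorphisms and anchors\<close>

lemma smooth_in_frame_lincomb:
  assumes "smooth_manifold (base E)" "openin (mtop (base E)) W"
    and "smooth_in_frame E s W X" "smooth_in_frame E s W Y"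
  shows "smooth_in_frame E s W (\<lambda>p. a *\<^sub>R X p + b *\<^sub>R Y p)"
proof -
  obtain c d where c: "\<forall>i<brank E. smooth_fun_on (base E) W (c i)"
      "\<forall>p\<in>W. X p = (\<Sum>i<brank E. c i p *\<^sub>R s i p)"
    and d: "\<forall>i<brank E. smooth_fun_on (base E) W (d i)"
      "\<forall>p\<in>W. Y p = (\<Sum>i<brank E. d i p *\<^sub>R s i p)"
    using assms(3,4) unfolding smooth_in_frame_def by blast
  show ?thesis
    unfolding smooth_in_frame_def
    by (rule exI[of _ "\<lambda>i p. a * c i p + b * d i p"])
      (use c d in \<open>auto intro!: smooth_fun_on_add smooth_fun_on_mult smooth_fun_on_const assms(1,2)
        simp: scaleR_add_left scaleR_sum_right sum.distrib\<close>)
qed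

lemma vector_bundle_frame:
  assumes "vector_bundle E" "(U, s) \<in> frames E"
  shows "openin (mtop (base E)) U" "\<And>p. p \<in> U \<Longrightarrow> p \<in> points (base E)"
    and "\<And>p i. p \<in> U \<Longrightarrow> i < brank E \<Longrightarrow> s i p \<in> fibre E p"
proof -
  have *: "openin (mtop (base E)) U \<and>
        (\<forall>p\<in>U. span ((\<lambda>i. s i p) ` {..<brank E}) = fibre E p)"
    using assms unfolding vector_bundle_def by blast
  then show "openin (mtop (base E)) U" by blast
  then show "p \<in> points (base E)" if "p \<in> U" for p using that openin_subset by blast
  show "s i p \<in> fibre E p" if "p \<in> U" "i < brank E" for p i
    using * that by (metis imageI lessThan_iff span_base)
qed

lemma fibre_lincomb:
  assumes "vector_bundle E" "p \<in> points (base E)" "u \<in> fibre E p" "v \<in> fibre E p"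
  shows "a *\<^sub>R u + b *\<^sub>R v \<in> fibre E p"
  using assms unfolding vector_bundle_def by (auto intro: subspace_add subspace_scale)

lemma section_in_fibre: "X \<in> sections E \<Longrightarrow> p \<in> points (base E) \<Longrightarrow> X p \<in> fibre E p"
  by (simp add: sections_def)

lemma section_outside: "X \<in> sections E \<Longrightarrow> p \<notin> points (base E) \<Longrightarrow> X p = 0"
  by (simp add: sections_def)

lemma section_eqI:
  assumes "X \<in> sections E" "Y \<in> sections E" "\<And>p. p \<in> points (base E) \<Longrightarrow> X p = Y p"
  shows "X = Y"
  using assms section_outside by (metis ext)

lemma section_lincomb:
  assumes "vector_bundle E" "X \<in> sections E" "Y \<in> sections E"
  shows "(\<lambda>p. a *\<^sub>R X p + b *\<^sub>R Y p) \<in> sections E"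
proof -
  have "smooth_manifold (base E)" using assms unfolding vector_bundle_def by blast
  then have "smooth_in_frame E s U (\<lambda>p. a *\<^sub>R X p + b *\<^sub>R Y p)" if "(U, s) \<in> frames E" for U s
    using assms that vector_bundle_frame(1)[OF assms(1) that]
    by (intro smooth_in_frame_lincomb) (auto simp: sections_def)
  then show ?thesis
    using assms fibre_lincomb[OF assms(1)] by (auto simp: sections_def)
qed

lemma section_add:
  assumes "vector_bundle E" "X \<in> sections E" "Y \<in> sections E"
  shows "(\<lambda>p. X p + Y p) \<in> sections E"
  using section_lincomb[OF assms, of 1 1] by simp

lemma section_diff:
  assumes "vector_bundle E" "X \<in> sections E" "Y \<in> sections E"
  shows "(\<lambda>p. X p - Y p) \<in> sections E"
  using section_lincomb[OF assms, of 1 "-1"] by simp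

section \<open>Endomorphisms and anchors as matrices in local frames\<close>

lemma tensor11_in_fibre:
  "tensor11 E A \<Longrightarrow> p \<in> points (base E) \<Longrightarrow> u \<in> fibre E p \<Longrightarrow> A p u \<in> fibre E p"
  by (simp add: tensor11_def)

lemma tensor11_lincomb:
  "tensor11 E A \<Longrightarrow> p \<in> points (base E) \<Longrightarrow> u \<in> fibre E p \<Longrightarrow> v \<in> fibre E p \<Longrightarrow>
    A p (a *\<^sub>R u + b *\<^sub>R v) = a *\<^sub>R A p u + b *\<^sub>R A p v"
  by (simp add: tensor11_def)

text \<open>Endomorphisms and anchors are total functions that are linear on each fibre only, hence
  linearity relative to a subspace \<open>F\<close>.\<close>

lemma fibre_map_sum:
  fixes L :: "'v::real_vector \<Rightarrow> 'w::real_vector"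
  assumes "subspace F" "\<And>u v a b. u \<in> F \<Longrightarrow> v \<in> F \<Longrightarrow> L (a *\<^sub>R u + b *\<^sub>R v) = a *\<^sub>R L u + b *\<^sub>R L v"
    and "finite J" "\<And>i. i \<in> J \<Longrightarrow> w i \<in> F"
  shows "L (\<Sum>i\<in>J. c i *\<^sub>R w i) = (\<Sum>i\<in>J. c i *\<^sub>R L (w i))"
  using assms(3,4)
proof (induction J rule: finite_induct)
  case empty
  \<comment> \<open>The combination with all vectors and coefficients 0 yields
    \<open>L 0 = 0\<close>.\<close>
  show ?case using assms(2)[of 0 0 0 0] subspace_0[OF assms(1)] by simp
next
  case (insert j J)
  have "(\<Sum>i\<in>J. c i *\<^sub>R w i) \<in> F"
    using insert.prems assms(1) by (intro subspace_sum subspace_scale) auto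
  then show ?case
    using insert assms(2)[of "w j" "\<Sum>i\<in>J. c i *\<^sub>R w i" "c j" 1] by simp
qed

text \<open>\<open>d\<close> is the matrix of \<open>A\<close> in the frame \<open>s\<close>; it
  comes from the smoothness clause of \<open>tensor11\<close> with both frames equal to
  \<open>(U, s)\<close>.\<close>

lemma tensor11_frame:
  assumes "vector_bundle E" "tensor11 E A" "(U, s) \<in> frames E"
  obtains d where "\<And>i j. i < brank E \<Longrightarrow> j < brank E \<Longrightarrow> smooth_fun_on (base E) U (d j i)"
    and "\<And>p j. p \<in> U \<Longrightarrow> j < brank E \<Longrightarrow> A p (s j p) = (\<Sum>i<brank E. d j i p *\<^sub>R s i p)"
proof -
  have "\<forall>j<brank E. smooth_in_frame E s U (\<lambda>p. A p (s j p))"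
    using assms(2,3) unfolding tensor11_def by fastforce
  then have "\<forall>j. \<exists>c. j<brank E \<longrightarrow> (\<forall>i<brank E. smooth_fun_on (base E) U (c i)) \<and>
          (\<forall>p\<in>U. A p (s j p) = (\<Sum>i<brank E. c i p *\<^sub>R s i p))"
    unfolding smooth_in_frame_def by blast
  then obtain d where "\<forall>j. j<brank E \<longrightarrow> (\<forall>i<brank E. smooth_fun_on (base E) U (d j i)) \<and>
          (\<forall>p\<in>U. A p (s j p) = (\<Sum>i<brank E. d j i p *\<^sub>R s i p))"
    by metis
  then show thesis using that by blast
qed

text \<open>In a frame, the components of the image are the matrix of \<open>A\<close> applied to
  the components of \<open>X\<close>, so they are sums of products of smooth functions.\<close>

lemma act_section:
  assumes E: "vector_bundle E" and A: "tensor11 E A" and X: "X \<in> sections E"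
  shows "act E A X \<in> sections E"
proof -
  have M: "smooth_manifold (base E)" using E unfolding vector_bundle_def by blast
  have "smooth_in_frame E s U (act E A X)" if Us: "(U, s) \<in> frames E" for U s
  proof -
    note fr = vector_bundle_frame[OF E Us]
    from tensor11_frame[OF E A Us] obtain d where
      d: "\<And>i j. i < brank E \<Longrightarrow> j < brank E \<Longrightarrow> smooth_fun_on (base E) U (d j i)"
      "\<And>p j. p \<in> U \<Longrightarrow> j < brank E \<Longrightarrow> A p (s j p) = (\<Sum>i<brank E. d j i p *\<^sub>R s i p)" by metis
    have "smooth_in_frame E s U X" using X Us by (auto simp: sections_def)
    then obtain c where c: "\<forall>i<brank E. smooth_fun_on (base E) U (c i)"
      "\<forall>p\<in>U. X p = (\<Sum>i<brank E. c i p *\<^sub>R s i p)"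
      unfolding smooth_in_frame_def by blast
    have "act E A X p = (\<Sum>i<brank E. (\<Sum>j<brank E. c j p * d j i p) *\<^sub>R s i p)" if p: "p \<in> U" for p
    proof -
      have "subspace (fibre E p)" using E fr(2)[OF p] unfolding vector_bundle_def by blast
      then have "A p (X p) = (\<Sum>j<brank E. c j p *\<^sub>R A p (s j p))"
        using fibre_map_sum[OF _ tensor11_lincomb[OF A fr(2)[OF p]], where J = "{..<brank E}" and
            w = "\<lambda>i. s i p" and c = "\<lambda>i. c i p"] c(2) p fr(3) by simp
      also have "\<dots> = (\<Sum>j<brank E. \<Sum>i<brank E. (c j p * d j i p) *\<^sub>R s i p)"
        using d(2)[OF p] by (simp add: scaleR_sum_right)
      also have "\<dots> = (\<Sum>i<brank E. (\<Sum>j<brank E. c j p * d j i p) *\<^sub>R s i p)"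
        by (subst sum.swap) (simp add: scaleR_sum_left)
      finally show ?thesis using fr(2)[OF p] by (simp add: act_def)
    qed
    moreover have "smooth_fun_on (base E) U (\<lambda>p. \<Sum>j<brank E. c j p * d j i p)"
      if "i < brank E" for i
      using c(1) d(1) that by (intro smooth_fun_on_sum smooth_fun_on_mult M fr(1)) auto
    ultimately show ?thesis
      unfolding smooth_in_frame_def
      by (intro exI[of _ "\<lambda>i p. \<Sum>j<brank E. c j p * d j i p"]) auto
  qed
  then show ?thesis
    using X tensor11_in_fibre[OF A] by (auto simp: sections_def act_def)
qed

text \<open>The coefficients of the composite in coordinate vector fields are the product of the
  matrices of \<open>A\<close> and of the anchor, restricted to \<open>U \<inter> V\<close>.\<close>

lemma anchor_map_comp:
  assumes E: "vector_bundle E" and A: "tensor11 E A" and \<rho>: "anchor_map E \<rho>"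
  shows "anchor_map E (\<lambda>p u. \<rho> p (A p u))"
proof -
  have M: "smooth_manifold (base E)" using E unfolding vector_bundle_def by blast
  \<comment> \<open>Real multiplication is written as scaling to fit \<open>fibre_map_sum\<close>
    with real values.\<close>
  have lin: "\<rho> p (a *\<^sub>R u + b *\<^sub>R v) f = a *\<^sub>R \<rho> p u f + b *\<^sub>R \<rho> p v f"
    if "p \<in> points (base E)" "u \<in> fibre E p" "v \<in> fibre E p" for p u v a b f
    using \<rho> that unfolding anchor_map_def by simp
  have "\<exists>c. (\<forall>i<mdim (base E). smooth_fun_on (base E) (U \<inter> V) (c i)) \<and>
            (\<forall>p\<in>U \<inter> V. \<forall>f\<in>Cinf (base E).
               \<rho> p (A p (s j p)) f = (\<Sum>i<mdim (base E). c i p * coord_vector (V, \<phi>) i p f))"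
    if Us: "(U, s) \<in> frames E" and V: "(V, \<phi>) \<in> atlas (base E)" and j: "j < brank E" for U s V \<phi> j
  proof -
    note fr = vector_bundle_frame[OF E Us]
    from tensor11_frame[OF E A Us] obtain d where
      d: "\<And>i j. i < brank E \<Longrightarrow> j < brank E \<Longrightarrow> smooth_fun_on (base E) U (d j i)"
      "\<And>p j. p \<in> U \<Longrightarrow> j < brank E \<Longrightarrow> A p (s j p) = (\<Sum>i<brank E. d j i p *\<^sub>R s i p)" by metis
    have "\<forall>l. \<exists>c. l < brank E \<longrightarrow> (\<forall>i<mdim (base E). smooth_fun_on (base E) (U \<inter> V) (c i)) \<and>
            (\<forall>p\<in>U \<inter> V. \<forall>f\<in>Cinf (base E).
               \<rho> p (s l p) f = (\<Sum>i<mdim (base E). c i p * coord_vector (V, \<phi>) i p f))"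
      using \<rho> Us V unfolding anchor_map_def by blast
    from choice[OF this] obtain c where
      c: "\<And>l i. l < brank E \<Longrightarrow> i < mdim (base E) \<Longrightarrow> smooth_fun_on (base E) (U \<inter> V) (c l i)"
      "\<And>l p f. l < brank E \<Longrightarrow> p \<in> U \<inter> V \<Longrightarrow> f \<in> Cinf (base E) \<Longrightarrow>
               \<rho> p (s l p) f = (\<Sum>i<mdim (base E). c l i p * coord_vector (V, \<phi>) i p f)"
      by blast
    have op: "openin (mtop (base E)) (U \<inter> V)"
      using fr(1) M V unfolding smooth_manifold_def by blast
    have "\<rho> p (A p (s j p)) f
        = (\<Sum>i<mdim (base E). (\<Sum>l<brank E. d j l p * c l i p) * coord_vector (V, \<phi>) i p f)"
      if p: "p \<in> U \<inter> V" and f: "f \<in> Cinf (base E)" for p f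
    proof -
      have pM: "p \<in> points (base E)" using fr(2) p by blast
      then have "subspace (fibre E p)" using E unfolding vector_bundle_def by blast
      then have "\<rho> p (A p (s j p)) f = (\<Sum>l<brank E. d j l p *\<^sub>R \<rho> p (s l p) f)"
        using d(2)[OF _ j] p fr(3)
        by (simp only: IntD1) (intro fibre_map_sum[where L = "\<lambda>u. \<rho> p u f"] lin[OF pM], auto)
      also have "\<dots> = (\<Sum>l<brank E. \<Sum>i<mdim (base E). d j l p * c l i p * coord_vector (V, \<phi>) i p f)"
        using c(2)[OF _ p f] by (simp add: sum_distrib_left mult.assoc)
      also have "\<dots> = (\<Sum>i<mdim (base E). (\<Sum>l<brank E. d j l p * c l i p) * coord_vector (V, \<phi>) i p f)"
        by (subst sum.swap) (simp add: sum_distrib_right)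
      finally show ?thesis .
    qed
    moreover have "smooth_fun_on (base E) (U \<inter> V) (\<lambda>p. \<Sum>l<brank E. d j l p * c l i p)"
      if "i < mdim (base E)" for i
      using c(1) d(1) j that
      by (intro smooth_fun_on_sum smooth_fun_on_mult M op)
        (auto intro: smooth_fun_on_subset[OF _ Int_lower1])
    ultimately show ?thesis
      by (intro exI[of _ "\<lambda>i p. \<Sum>l<brank E. d j l p * c l i p"]) auto
  qed
  then show ?thesis
    using \<rho> tensor11_in_fibre[OF A] tensor11_lincomb[OF A]
    unfolding anchor_map_def by auto
qed

section \<open>Tangent vectors and sums of anchors\<close>

lemma tangent_space_add:
  assumes "v \<in> tangent_space M p" "w \<in> tangent_space M p"
  shows "(\<lambda>f. v f + w f) \<in> tangent_space M p"
  using assms by (auto simp: tangent_space_def algebra_simps)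

lemma anchor_map_add:
  assumes E: "vector_bundle E" and \<rho>: "anchor_map E \<rho>" and \<sigma>: "anchor_map E \<sigma>"
  shows "anchor_map E (\<lambda>p u f. \<rho> p u f + \<sigma> p u f)"
proof -
  have M: "smooth_manifold (base E)" using E unfolding vector_bundle_def by blast
  have "\<exists>c. (\<forall>i<mdim (base E). smooth_fun_on (base E) (U \<inter> V) (c i)) \<and>
            (\<forall>p\<in>U \<inter> V. \<forall>f\<in>Cinf (base E).
               \<rho> p (s j p) f + \<sigma> p (s j p) f = (\<Sum>i<mdim (base E). c i p * coord_vector (V, \<phi>) i p f))"
    if Us: "(U, s) \<in> frames E" and V: "(V, \<phi>) \<in> atlas (base E)" and j: "j < brank E" for U s V \<phi> j
  proof -
    have op: "openin (mtop (base E)) (U \<inter> V)"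
      using vector_bundle_frame(1)[OF E Us] M V unfolding smooth_manifold_def by blast
    obtain c where c: "\<forall>i<mdim (base E). smooth_fun_on (base E) (U \<inter> V) (c i)"
      "\<forall>p\<in>U \<inter> V. \<forall>f\<in>Cinf (base E).
         \<rho> p (s j p) f = (\<Sum>i<mdim (base E). c i p * coord_vector (V, \<phi>) i p f)"
      using \<rho> Us V j unfolding anchor_map_def by blast
    obtain d where d: "\<forall>i<mdim (base E). smooth_fun_on (base E) (U \<inter> V) (d i)"
      "\<forall>p\<in>U \<inter> V. \<forall>f\<in>Cinf (base E).
         \<sigma> p (s j p) f = (\<Sum>i<mdim (base E). d i p * coord_vector (V, \<phi>) i p f)"
      using \<sigma> Us V j unfolding anchor_map_def by blast
    show ?thesis
      by (rule exI[of _ "\<lambda>i p. c i p + d i p"])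
        (use c d in \<open>auto intro: smooth_fun_on_add[OF M op] simp: sum.distrib distrib_right\<close>)
  qed
  moreover have "(\<lambda>f. \<rho> p u f + \<sigma> p u f) \<in> tangent_space (base E) p"
    if "p \<in> points (base E)" "u \<in> fibre E p" for p u
    by (rule tangent_space_add) (use \<rho> \<sigma> that in \<open>auto simp: anchor_map_def\<close>)
  moreover have "\<rho> p (a *\<^sub>R u + b *\<^sub>R v) f + \<sigma> p (a *\<^sub>R u + b *\<^sub>R v) f
      = a * (\<rho> p u f + \<sigma> p u f) + b * (\<rho> p v f + \<sigma> p v f)"
    if "p \<in> points (base E)" "u \<in> fibre E p" "v \<in> fibre E p" for p u v a b f
    using \<rho> \<sigma> that unfolding anchor_map_def by (simp add: algebra_simps)
  ultimately show ?thesis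
    unfolding anchor_map_def by blast
qed

text \<open>Also valid for functions outside \<^term>\<open>Cinf M\<close>, on which tangent vectors vanish.\<close>

lemma tangent_uminus:
  assumes "v \<in> tangent_space M p"
  shows "v (\<lambda>q. - f q) = - v f"
proof -
  have neg: "v (\<lambda>q. - h q) = - v h" if "h \<in> Cinf M" for h
  proof -
    have "v (\<lambda>q. (-1) * h q + 0 * h q) = (-1) * v h + 0 * v h"
      using assms that unfolding tangent_space_def by blast
    then show ?thesis by simp
  qed
  show ?thesis
  proof (cases "f \<in> Cinf M \<or> (\<lambda>q. - f q) \<in> Cinf M")
    case True
    then show ?thesis using neg[of f] neg[of "\<lambda>q. - f q"] by auto
  next
    case False
    then show ?thesis using assms by (simp add: tangent_space_def)
  qed
qed

section \<open>Deformation of pre-Courant structures\<close>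

lemma
  assumes "fibre_form E g" "p \<in> points (base E)" "subspace (fibre E p)"
    and "u \<in> fibre E p" "v \<in> fibre E p" "w \<in> fibre E p"
  shows fibre_form_add_left: "g p (u + v) w = g p u w + g p v w"
    and fibre_form_add_right: "g p w (u + v) = g p w u + g p w v"
    and fibre_form_diff_left: "g p (u - v) w = g p u w - g p v w"
    and fibre_form_diff_right: "g p w (u - v) = g p w u - g p w v"
proof -
  have lin: "g p (a *\<^sub>R u + b *\<^sub>R v) w = a * g p u w + b * g p v w" for a b
    using assms by (simp add: fibre_form_def)
  have sym: "g p x y = g p y x" if "x \<in> fibre E p" "y \<in> fibre E p" for x y
    using assms that by (simp add: fibre_form_def)
  show 1: "g p (u + v) w = g p u w + g p v w" using lin[of 1 1] by simp
  show 2: "g p (u - v) w = g p u w - g p v w" using lin[of 1 "-1"] by simp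
  show "g p w (u + v) = g p w u + g p w v" "g p w (u - v) = g p w u - g p w v"
    using 1 2 sym[of w] assms(3-6) by (simp_all add: subspace_add subspace_diff)
qed

text \<open>In both metric axioms the brackets with \<open>A\<close> on the first slot of the
  anchor, or with \<open>A\<close> moved from the bracket to \<open>X\<close>, give the derivative
  along \<open>A X\<close>. The other terms add up to the derivative along \<open>X\<close> of the
  pairing of \<open>A Y\<close> with \<open>Z\<close> plus that of \<open>Y\<close> with
  \<open>A Z\<close>, which is 0 by skew-symmetry.\<close>

lemma pre_courant_deform:
  assumes E: "vector_bundle E" and g: "fibre_form E g" and A: "tensor11 E A"
    and skew: "skew_symmetric E g A" and \<Theta>: "pre_courant E g \<Theta>"
  shows "pre_courant E g (deform E A \<Theta>)"
proof -
  note dd = act_section[OF E A]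
  have br: "dorfman \<Theta> X Y \<in> sections E" if "X \<in> sections E" "Y \<in> sections E" for X Y
    using \<Theta> that unfolding pre_courant_def by blast
  have actlin: "act E A (\<lambda>q. a *\<^sub>R X q + b *\<^sub>R Y q) = (\<lambda>q. a *\<^sub>R act E A X q + b *\<^sub>R act E A Y q)"
    if "X \<in> sections E" "Y \<in> sections E" for X Y a b
    using tensor11_lincomb[OF A _ section_in_fibre[OF that(1)] section_in_fibre[OF that(2)]]
    by (auto simp: act_def)
  have lin: "dorfman \<Theta> (\<lambda>q. a *\<^sub>R X q + b *\<^sub>R Y q) Z p
          = a *\<^sub>R dorfman \<Theta> X Z p + b *\<^sub>R dorfman \<Theta> Y Z p"
        "dorfman \<Theta> Z (\<lambda>q. a *\<^sub>R X q + b *\<^sub>R Y q) p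
          = a *\<^sub>R dorfman \<Theta> Z X p + b *\<^sub>R dorfman \<Theta> Z Y p"
    if "X \<in> sections E" "Y \<in> sections E" "Z \<in> sections E" "p \<in> points (base E)" for X Y Z a b p
    using \<Theta> that unfolding pre_courant_def by blast+
  have ax: "anchor \<Theta> p (X p) (pairing E g Y Z)
          = g p (dorfman \<Theta> X Y p) (Z p) + g p (Y p) (dorfman \<Theta> X Z p)"
        "anchor \<Theta> p (X p) (pairing E g Y Z)
          = g p (X p) (dorfman \<Theta> Y Z p + dorfman \<Theta> Z Y p)"
    if "X \<in> sections E" "Y \<in> sections E" "Z \<in> sections E" "p \<in> points (base E)" for X Y Z p
    using \<Theta> that unfolding pre_courant_def by blast+
  have sk: "g p (A p u) v = - g p u (A p v)"
    if "p \<in> points (base E)" "u \<in> fibre E p" "v \<in> fibre E p" for p u v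
    using skew that unfolding skew_symmetric_def by (simp add: eq_neg_iff_add_eq_0)
  have lin_act: "act E A (dorfman \<Theta> (\<lambda>q. a *\<^sub>R X q + b *\<^sub>R Y q) Z) p
          = a *\<^sub>R act E A (dorfman \<Theta> X Z) p + b *\<^sub>R act E A (dorfman \<Theta> Y Z) p"
        "act E A (dorfman \<Theta> Z (\<lambda>q. a *\<^sub>R X q + b *\<^sub>R Y q)) p
          = a *\<^sub>R act E A (dorfman \<Theta> Z X) p + b *\<^sub>R act E A (dorfman \<Theta> Z Y) p"
    if "X \<in> sections E" "Y \<in> sections E" "Z \<in> sections E" "p \<in> points (base E)" for X Y Z a b p
    using that by (simp_all add: act_def lin tensor11_lincomb[OF A] section_in_fibre br)
  show ?thesis
    unfolding pre_courant_def
  proof (intro conjI ballI allI)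
    show "anchor_map E (anchor (deform E A \<Theta>))"
      using anchor_map_comp[OF E A] \<Theta> by (simp add: deform_def pre_courant_def)
  next
    fix X Y assume "X \<in> sections E" "Y \<in> sections E"
    then show "dorfman (deform E A \<Theta>) X Y \<in> sections E"
      by (auto simp: deform_def intro!: section_add section_diff E br dd)
  next
    fix X Y Z a b p
    assume *: "X \<in> sections E" "Y \<in> sections E" "Z \<in> sections E" "p \<in> points (base E)"
    then show "dorfman (deform E A \<Theta>) (\<lambda>q. a *\<^sub>R X q + b *\<^sub>R Y q) Z p
          = a *\<^sub>R dorfman (deform E A \<Theta>) X Z p + b *\<^sub>R dorfman (deform E A \<Theta>) Y Z p"
      "dorfman (deform E A \<Theta>) Z (\<lambda>q. a *\<^sub>R X q + b *\<^sub>R Y q) p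
          = a *\<^sub>R dorfman (deform E A \<Theta>) Z X p + b *\<^sub>R dorfman (deform E A \<Theta>) Z Y p"
      by (simp_all add: deform_def actlin lin lin_act dd scaleR_add_right scaleR_diff_right)
  next
    fix X Y Z p
    assume X: "X \<in> sections E" and Y: "Y \<in> sections E" and Z: "Z \<in> sections E"
      and p: "p \<in> points (base E)"
    note fib = section_in_fibre[OF _ p]
    have sub: "subspace (fibre E p)" using E p unfolding vector_bundle_def by blast
    note bil = fibre_form_add_left[OF g p sub] fibre_form_add_right[OF g p sub]
      fibre_form_diff_left[OF g p sub] fibre_form_diff_right[OF g p sub]
      subspace_add[OF sub] subspace_diff[OF sub] fib br dd tensor11_in_fibre[OF A p]
    have A_add: "A p (u + v) = A p u + A p v" if "u \<in> fibre E p" "v \<in> fibre E p" for u v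
      using tensor11_lincomb[OF A p that, of 1 1] by simp
    have actp: "act E A W p = A p (W p)" for W using p by (simp add: act_def)
    \<comment> \<open>This is an equality of total functions, both sides being 0 off the manifold,
      so it can be placed under the anchor.\<close>
    have "pairing E g (act E A Y) Z = (\<lambda>q. - pairing E g Y (act E A Z) q)"
      using sk section_in_fibre Y Z by (fastforce simp: pairing_def act_def fun_eq_iff)
    moreover have "anchor \<Theta> p (X p) \<in> tangent_space (base E) p"
      using \<Theta> fib[OF X] p by (simp add: pre_courant_def anchor_map_def)
    ultimately have z: "anchor \<Theta> p (X p) (pairing E g (act E A Y) Z)
        = - anchor \<Theta> p (X p) (pairing E g Y (act E A Z))"
      using tangent_uminus by metis
    \<comment> \<open>The anchor of the deformed structure at \<open>X p\<close> is the old one at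
      \<open>act E A X p\<close>, so the axiom of \<open>\<Theta>\<close> is used at that
      section.\<close>
    have "anchor \<Theta> p (act E A X p) (pairing E g Y Z)
          = g p (dorfman \<Theta> (act E A X) Y p) (Z p) + g p (Y p) (dorfman \<Theta> (act E A X) Z p)"
      using ax(1)[OF dd[OF X] Y Z p] .
    then show "anchor (deform E A \<Theta>) p (X p) (pairing E g Y Z)
          = g p (dorfman (deform E A \<Theta>) X Y p) (Z p) + g p (Y p) (dorfman (deform E A \<Theta>) X Z p)"
      using z ax(1)[OF X dd[OF Y] Z p] ax(1)[OF X Y dd[OF Z] p] X Y Z
      by (simp add: deform_def bil actp sk p)
    have "anchor \<Theta> p (act E A X p) (pairing E g Y Z)
          = g p (act E A X p) (dorfman \<Theta> Y Z p + dorfman \<Theta> Z Y p)"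
      using ax(2)[OF dd[OF X] Y Z p] .
    then show "anchor (deform E A \<Theta>) p (X p) (pairing E g Y Z)
          = g p (X p) (dorfman (deform E A \<Theta>) Y Z p + dorfman (deform E A \<Theta>) Z Y p)"
      using z ax(2)[OF X dd[OF Y] Z p] ax(2)[OF X Y dd[OF Z] p] X Y Z
      by (simp add: deform_def bil A_add actp sk p)
  qed
qed

text \<open>All axioms of a pre-Courant structure are linear in the pair of anchor and bracket. Only
  the Leibniz identity is quadratic; it is treated algebraically below.\<close>

lemma pre_courant_sum:
  assumes E: "vector_bundle E" and g: "fibre_form E g"
    and \<Theta>: "pre_courant E g \<Theta>" and \<Psi>: "pre_courant E g \<Psi>"
  shows "pre_courant E g (structure_sum \<Theta> \<Psi>)"
  unfolding pre_courant_def
proof (intro conjI ballI allI)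
  have br: "dorfman \<Theta> X Y \<in> sections E" "dorfman \<Psi> X Y \<in> sections E"
    if "X \<in> sections E" "Y \<in> sections E" for X Y
    using \<Theta> \<Psi> that by (simp_all add: pre_courant_def)
  show "anchor_map E (anchor (structure_sum \<Theta> \<Psi>))"
    using anchor_map_add[OF E] \<Theta> \<Psi> by (simp add: structure_sum_def pre_courant_def)
  show "dorfman (structure_sum \<Theta> \<Psi>) X Y \<in> sections E"
    if "X \<in> sections E" "Y \<in> sections E" for X Y
    using that by (auto simp: structure_sum_def intro!: section_add E br)
  fix X Y Z a b p
  assume X: "X \<in> sections E" and Y: "Y \<in> sections E" and Z: "Z \<in> sections E"
    and p: "p \<in> points (base E)"
  show "dorfman (structure_sum \<Theta> \<Psi>) (\<lambda>q. a *\<^sub>R X q + b *\<^sub>R Y q) Z p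
        = a *\<^sub>R dorfman (structure_sum \<Theta> \<Psi>) X Z p + b *\<^sub>R dorfman (structure_sum \<Theta> \<Psi>) Y Z p"
    "dorfman (structure_sum \<Theta> \<Psi>) Z (\<lambda>q. a *\<^sub>R X q + b *\<^sub>R Y q) p
        = a *\<^sub>R dorfman (structure_sum \<Theta> \<Psi>) Z X p + b *\<^sub>R dorfman (structure_sum \<Theta> \<Psi>) Z Y p"
    using \<Theta> \<Psi> X Y Z p unfolding pre_courant_def
    by (simp_all add: structure_sum_def scaleR_add_right)
  have sub: "subspace (fibre E p)" using E p unfolding vector_bundle_def by blast
  note bil = fibre_form_add_left[OF g p sub] fibre_form_add_right[OF g p sub]
      subspace_add[OF sub] section_in_fibre[OF _ p] br
  have ax: "anchor \<Phi> p (X p) (pairing E g Y Z)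
          = g p (dorfman \<Phi> X Y p) (Z p) + g p (Y p) (dorfman \<Phi> X Z p)"
        "anchor \<Phi> p (X p) (pairing E g Y Z)
          = g p (X p) (dorfman \<Phi> Y Z p + dorfman \<Phi> Z Y p)"
    if "pre_courant E g \<Phi>" for \<Phi>
    using X Y Z p that unfolding pre_courant_def by blast+
  show "anchor (structure_sum \<Theta> \<Psi>) p (X p) (pairing E g Y Z)
      = g p (dorfman (structure_sum \<Theta> \<Psi>) X Y p) (Z p)
        + g p (Y p) (dorfman (structure_sum \<Theta> \<Psi>) X Z p)"
    using ax(1)[OF \<Theta>] ax(1)[OF \<Psi>] X Y Z by (simp add: structure_sum_def bil)
  show "anchor (structure_sum \<Theta> \<Psi>) p (X p) (pairing E g Y Z)
      = g p (X p) (dorfman (structure_sum \<Theta> \<Psi>) Y Z p + dorfman (structure_sum \<Theta> \<Psi>) Z Y p)"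
    using ax(2)[OF \<Theta>] ax(2)[OF \<Psi>] X Y Z by (simp add: structure_sum_def bil)
qed

section \<open>Nijenhuis operators on Leibniz algebras\<close>

text \<open>Stated relative to a set because the sections form a proper kind of subgroup inside a
  function type.\<close>

definition biadditive_on :: "'a::ab_group_add set \<Rightarrow> ('a \<Rightarrow> 'a \<Rightarrow> 'a) \<Rightarrow> bool" where
  "biadditive_on S \<mu> \<longleftrightarrow> (\<forall>x\<in>S. \<forall>y\<in>S. \<mu> x y \<in> S) \<and>
     (\<forall>x\<in>S. \<forall>y\<in>S. \<forall>z\<in>S. \<mu> (x + y) z = \<mu> x z + \<mu> y z \<and> \<mu> z (x + y) = \<mu> z x + \<mu> z y)"

text \<open>The defect in the Leibniz identity with outer bracket \<open>\<mu>\<close> and inner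
  bracket \<open>\<nu>\<close>. The polarization \<open>C(\<mu>, \<nu>)\<close> is its sum over both
  orders of the two brackets.\<close>

definition leibnizator ::
    "('a::ab_group_add \<Rightarrow> 'a \<Rightarrow> 'a) \<Rightarrow> ('a \<Rightarrow> 'a \<Rightarrow> 'a) \<Rightarrow> 'a \<Rightarrow> 'a \<Rightarrow> 'a \<Rightarrow> 'a" where
  "leibnizator \<mu> \<nu> x y z = \<mu> x (\<nu> y z) - \<mu> (\<nu> x y) z - \<mu> y (\<nu> x z)"

text \<open>The coefficient of \<open>t\<close> in the conjugate of \<open>\<mu>\<close> by
  \<open>1 + t T\<close>, that is, in \<open>(1 + t T)^(-1)\<close> applied to
  \<open>\<mu> ((1 + t T) x) ((1 + t T) y)\<close>.\<close>

definition deformed :: "('a \<Rightarrow> 'a) \<Rightarrow> ('a::ab_group_add \<Rightarrow> 'a \<Rightarrow> 'a) \<Rightarrow> 'a \<Rightarrow> 'a \<Rightarrow> 'a" where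
  "deformed T \<mu> x y = \<mu> (T x) y + \<mu> x (T y) - T (\<mu> x y)"

locale additive_endo =
  fixes S :: "'a::ab_group_add set" and T :: "'a \<Rightarrow> 'a"
  assumes zero: "0 \<in> S" and diff: "x \<in> S \<Longrightarrow> y \<in> S \<Longrightarrow> x - y \<in> S"
    and T_closed: "x \<in> S \<Longrightarrow> T x \<in> S"
    and T_add: "x \<in> S \<Longrightarrow> y \<in> S \<Longrightarrow> T (x + y) = T x + T y"
begin

lemma add: "x \<in> S \<Longrightarrow> y \<in> S \<Longrightarrow> x + y \<in> S"
  using diff[of x "0 - y"] diff[OF zero, of y] by simp

lemma T_zero: "T 0 = 0"
  using T_add[OF zero zero] by simp

lemma T_diff: "x \<in> S \<Longrightarrow> y \<in> S \<Longrightarrow> T (x - y) = T x - T y"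
  using T_add[of "x - y" y] diff by simp

lemma biadditive_on_rules:
  assumes "biadditive_on S \<mu>" "x \<in> S" "y \<in> S"
  shows "\<mu> x y \<in> S"
    and "z \<in> S \<Longrightarrow> \<mu> (x + y) z = \<mu> x z + \<mu> y z" "z \<in> S \<Longrightarrow> \<mu> z (x + y) = \<mu> z x + \<mu> z y"
    and "z \<in> S \<Longrightarrow> \<mu> (x - y) z = \<mu> x z - \<mu> y z" "z \<in> S \<Longrightarrow> \<mu> z (x - y) = \<mu> z x - \<mu> z y"
proof -
  show "\<mu> x y \<in> S" using assms by (simp add: biadditive_on_def)
  have "\<mu> (u + v) z = \<mu> u z + \<mu> v z" "\<mu> z (u + v) = \<mu> z u + \<mu> z v"
    if "u \<in> S" "v \<in> S" "z \<in> S" for u v z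
    using assms(1) that by (simp_all add: biadditive_on_def)
  \<comment> \<open>The second instance is additivity at \<open>(x - y) + y\<close>, which yields
    the rules for differences.\<close>
  note * = this[OF assms(2,3)] this[OF diff[OF assms(2,3)] assms(3)]
  show "\<mu> (x + y) z = \<mu> x z + \<mu> y z" "\<mu> z (x + y) = \<mu> z x + \<mu> z y"
    "\<mu> (x - y) z = \<mu> x z - \<mu> y z" "\<mu> z (x - y) = \<mu> z x - \<mu> z y" if "z \<in> S"
    using * that by (simp_all add: algebra_simps)
qed

lemma biadditive_on_deformed:
  assumes "biadditive_on S \<mu>"
  shows "biadditive_on S (deformed T \<mu>)"
  unfolding biadditive_on_def[of S "deformed T \<mu>"]
  by (simp add: deformed_def T_add T_closed add diff biadditive_on_rules[OF assms])

text \<open>Deformation by \<^term>\<open>T\<close> is the infinitesimal action of \<^term>\<open>T\<close> on multilinear maps, so it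
  acts as a derivation on the quadratic expression \<^const>\<open>leibnizator\<close>.\<close>

lemma leibnizator_deformed:
  assumes "biadditive_on S \<mu>" "biadditive_on S \<nu>" "x \<in> S" "y \<in> S" "z \<in> S"
  shows "leibnizator (deformed T \<mu>) \<nu> x y z + leibnizator \<mu> (deformed T \<nu>) x y z
    = leibnizator \<mu> \<nu> (T x) y z + leibnizator \<mu> \<nu> x (T y) z + leibnizator \<mu> \<nu> x y (T z)
      - T (leibnizator \<mu> \<nu> x y z)"
  using assms(3-5)
  by (simp add: leibnizator_def deformed_def T_closed T_add T_diff add diff
      biadditive_on_rules[OF assms(1)] biadditive_on_rules[OF assms(2)])

section \<open>Leibniz brackets, compatible pairs and the torsion condition\<close>

definition leibniz :: "('a \<Rightarrow> 'a \<Rightarrow> 'a) \<Rightarrow> bool" where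
  "leibniz \<mu> \<longleftrightarrow> biadditive_on S \<mu> \<and> (\<forall>x\<in>S. \<forall>y\<in>S. \<forall>z\<in>S. leibnizator \<mu> \<mu> x y z = 0)"

text \<open>This is \<open>C(\<mu>, \<nu>) = 0\<close>. For equal brackets it says only that twice
  the defect vanishes, which in a general abelian group is weaker than
  \<open>leibniz\<close>.\<close>

definition cross_leibniz :: "('a \<Rightarrow> 'a \<Rightarrow> 'a) \<Rightarrow> ('a \<Rightarrow> 'a \<Rightarrow> 'a) \<Rightarrow> bool" where
  "cross_leibniz \<mu> \<nu> \<longleftrightarrow>
     (\<forall>x\<in>S. \<forall>y\<in>S. \<forall>z\<in>S. leibnizator \<mu> \<nu> x y z + leibnizator \<nu> \<mu> x y z = 0)"

text \<open>Torsion means the Nijenhuis torsion of \<open>T\<close> with respect to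
  \<open>\<mu>\<close>, not torsion of the group.\<close>

definition torsion_free :: "('a \<Rightarrow> 'a \<Rightarrow> 'a) \<Rightarrow> bool" where
  "torsion_free \<mu> \<longleftrightarrow> (\<forall>x\<in>S. \<forall>y\<in>S. \<mu> (T x) (T y) = T (deformed T \<mu> x y))"

lemma cross_leibniz_commute: "cross_leibniz \<mu> \<nu> \<longleftrightarrow> cross_leibniz \<nu> \<mu>"
  by (simp add: cross_leibniz_def add.commute)

text \<open>In \<open>leibnizator_deformed\<close> with equal brackets the left side is
  \<open>C(\<mu>, deformed T \<mu>)\<close> and every term on the right is a defect of
  \<open>\<mu>\<close>.\<close>

lemma cross_leibniz_deformed_self:
  assumes "leibniz \<mu>"
  shows "cross_leibniz \<mu> (deformed T \<mu>)"
  unfolding cross_leibniz_def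
proof (intro ballI)
  fix x y z assume "x \<in> S" "y \<in> S" "z \<in> S"
  then show "leibnizator \<mu> (deformed T \<mu>) x y z + leibnizator (deformed T \<mu>) \<mu> x y z = 0"
    using assms leibnizator_deformed[of \<mu> \<mu> x y z]
    by (simp add: leibniz_def T_closed T_zero add.commute)
qed

lemma leibnizator_closed:
  assumes "biadditive_on S \<mu>" "biadditive_on S \<nu>" "x \<in> S" "y \<in> S" "z \<in> S"
  shows "leibnizator \<mu> \<nu> x y z \<in> S"
  using assms(3-5)
  by (simp add: leibnizator_def diff biadditive_on_rules[OF assms(1)] biadditive_on_rules[OF assms(2)])

text \<open>Adding \<open>leibnizator_deformed\<close> for both orders expresses
  \<open>C(deformed T \<mu>, \<nu>) + C(\<mu>, deformed T \<nu>)\<close> through values of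
  \<open>C(\<mu>, \<nu>)\<close>, so one summand vanishes with the other.\<close>

lemma cross_leibniz_step:
  assumes "biadditive_on S \<mu>" "biadditive_on S \<nu>"
    and "cross_leibniz \<mu> \<nu>" "cross_leibniz (deformed T \<mu>) \<nu>"
  shows "cross_leibniz \<mu> (deformed T \<nu>)"
  unfolding cross_leibniz_def
proof (intro ballI)
  fix x y z assume xyz: "x \<in> S" "y \<in> S" "z \<in> S"
  let ?c = "\<lambda>\<mu> \<nu> x y z. leibnizator \<mu> \<nu> x y z + leibnizator \<nu> \<mu> x y z"
  have "?c (deformed T \<mu>) \<nu> x y z + ?c \<mu> (deformed T \<nu>) x y z
      = ?c \<mu> \<nu> (T x) y z + ?c \<mu> \<nu> x (T y) z + ?c \<mu> \<nu> x y (T z) - T (?c \<mu> \<nu> x y z)"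
    using arg_cong2[OF leibnizator_deformed[OF assms(1,2) xyz]
        leibnizator_deformed[OF assms(2,1) xyz], of "(+)"]
      T_add[OF leibnizator_closed[OF assms(1,2) xyz] leibnizator_closed[OF assms(2,1) xyz]]
    by (simp add: algebra_simps)
  then show "?c \<mu> (deformed T \<nu>) x y z = 0"
    using assms(3,4) xyz unfolding cross_leibniz_def by (simp add: T_closed T_zero)
qed

text \<open>This is the second order coefficient of
  \<open>(1 + t T) (leibnizator (\<mu> + t \<mu>') (\<mu> + t \<mu>') x y z)
    = leibnizator \<mu> \<mu> ((1 + t T) x) ((1 + t T) y) ((1 + t T) z)\<close> where \<open>\<mu>'\<close> is the
  deformed bracket: for torsion-free \<^term>\<open>\<mu>\<close> the map \<open>1 + t T\<close> is a homomorphism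
  from \<open>\<mu> + t \<mu>'\<close> to \<^term>\<open>\<mu>\<close>.\<close>

lemma leibnizator_deformed_deformed:
  assumes "biadditive_on S \<mu>" "torsion_free \<mu>" "x \<in> S" "y \<in> S" "z \<in> S"
  shows "leibnizator (deformed T \<mu>) (deformed T \<mu>) x y z
    = leibnizator \<mu> \<mu> (T x) (T y) z + leibnizator \<mu> \<mu> (T x) y (T z) + leibnizator \<mu> \<mu> x (T y) (T z)
      - T (leibnizator \<mu> (deformed T \<mu>) x y z + leibnizator (deformed T \<mu>) \<mu> x y z)"
proof -
  have *: "\<mu> (T u) (T v) = T (\<mu> (T u) v) + T (\<mu> u (T v)) - T (T (\<mu> u v))"
    if "u \<in> S" "v \<in> S" for u v
    using assms(2) that
    by (simp add: torsion_free_def deformed_def T_closed T_add T_diff add diff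
        biadditive_on_rules[OF assms(1)])
  show ?thesis
    using assms(3-5)
    by (simp add: leibnizator_def deformed_def T_closed T_add T_diff add diff *
        biadditive_on_rules[OF assms(1)])
qed

text \<open>On the right of \<open>leibnizator_deformed_deformed\<close>, the first three terms
  vanish since \<open>\<mu>\<close> is Leibniz, and the last is \<open>T\<close> of a polarization
  that vanishes by \<open>cross_leibniz_deformed_self\<close>.\<close>

lemma leibniz_deformed:
  assumes "leibniz \<mu>" "torsion_free \<mu>"
  shows "leibniz (deformed T \<mu>)"
  using assms cross_leibniz_deformed_self[OF assms(1)]
  by (simp add: leibniz_def cross_leibniz_def biadditive_on_deformed
      leibnizator_deformed_deformed T_closed T_zero)

text \<open>With \<open>\<mu>'\<close> the deformed bracket, torsion-freeness turns the three terms
  of \<open>\<mu>' (T x) (T y)\<close> into \<open>T (\<mu>' (T x) y)\<close>,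
  \<open>T (\<mu>' x (T y))\<close> and \<open>- T (T (\<mu>' x y))\<close>, whose sum is
  \<open>T\<close> of the twice deformed bracket.\<close>

lemma torsion_free_deformed:
  assumes "biadditive_on S \<mu>" "torsion_free \<mu>"
  shows "torsion_free (deformed T \<mu>)"
  unfolding torsion_free_def
proof (intro ballI)
  fix x y assume xy: "x \<in> S" "y \<in> S"
  note rules = biadditive_on_rules[OF assms(1)]
  have *: "\<mu> (T u) (T v) = T (\<mu> (T u) v) + T (\<mu> u (T v)) - T (T (\<mu> u v))"
    if "u \<in> S" "v \<in> S" for u v
    using assms(2) that
    by (simp add: torsion_free_def deformed_def T_closed T_add T_diff add diff rules)
  show "deformed T \<mu> (T x) (T y) = T (deformed T (deformed T \<mu>) x y)"
    using xy by (simp add: deformed_def T_closed T_add T_diff add diff rules *)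
qed

theorem cross_leibniz_iterated:
  assumes "leibniz \<mu>" "torsion_free \<mu>"
  shows "leibniz ((deformed T ^^ k) \<mu>)"
    and "cross_leibniz ((deformed T ^^ k) \<mu>) ((deformed T ^^ m) \<mu>)"
proof -
  let ?m = "\<lambda>k. (deformed T ^^ k) \<mu>"
  have leib: "leibniz (?m k) \<and> torsion_free (?m k)" for k
  proof (induction k)
    case (Suc k)
    then have "biadditive_on S (?m k)" by (simp add: leibniz_def)
    then show ?case using Suc leibniz_deformed torsion_free_deformed by simp
  qed (use assms in simp)
  then show "leibniz (?m k)" by blast
  have bi: "biadditive_on S (?m k)" for k using leib by (simp add: leibniz_def)
  have "cross_leibniz (?m k) (?m (k + n))" for n k
  \<comment> \<open>Gap \<open>l + 2\<close> at \<open>k\<close> needs gap \<open>l + 1\<close> at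
    \<open>k\<close> and gap \<open>l\<close> at \<open>k + 1\<close>, hence strong induction with
    \<open>k\<close> free.\<close>
  proof (induction n arbitrary: k rule: less_induct)
    case (less n)
    \<comment> \<open>Gap 1 is a base case: \<open>cross_leibniz_step\<close> from gap 0 would ask
      for the pair \<open>k + 1\<close>, \<open>k\<close>, which is the claim itself.\<close>
    consider "n = 0" | "n = 1" | l where "n = Suc (Suc l)"
      using not0_implies_Suc[of n] not0_implies_Suc[of "n - 1"] by force
    then show ?case
    proof cases
      case 1
      then show ?thesis using leib[of k] by (simp add: leibniz_def cross_leibniz_def)
    next
      case 2
      then show ?thesis using leib[of k] cross_leibniz_deformed_self by simp
    next
      case 3
      have "cross_leibniz (?m k) (?m (k + Suc l))" "cross_leibniz (?m (Suc k)) (?m (Suc k + l))"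
        using less.IH[of "Suc l" k] less.IH[of l "Suc k"] 3 by auto
      then show ?thesis
        using cross_leibniz_step[OF bi bi, of k "k + Suc l"] 3 by simp
    qed
  qed
  \<comment> \<open>Subtraction is truncated: the first instance serves \<open>k \<le> m\<close>,
    the second, with symmetry, the other case.\<close>
  from this[of k "m - k"] this[of m "k - m"]
  show "cross_leibniz (?m k) (?m m)"
    by (cases "k \<le> m") (auto simp: cross_leibniz_commute)
qed

lemma leibnizator_sum:
  assumes "biadditive_on S \<mu>" "biadditive_on S \<nu>" "x \<in> S" "y \<in> S" "z \<in> S"
  shows "leibnizator (\<lambda>x y. \<mu> x y + \<nu> x y) (\<lambda>x y. \<mu> x y + \<nu> x y) x y z
    = leibnizator \<mu> \<mu> x y z + leibnizator \<nu> \<nu> x y z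
      + (leibnizator \<mu> \<nu> x y z + leibnizator \<nu> \<mu> x y z)"
  using assms(3-5)
  by (simp add: leibnizator_def biadditive_on_rules[OF assms(1)] biadditive_on_rules[OF assms(2)])

end

section \<open>Compatibility of the deformed structures\<close>

lemma additive_endo_act:
  assumes "vector_bundle E" "tensor11 E A"
  shows "additive_endo (sections E) (act E A)"
proof
  have "smooth_in_frame E s U 0" for s U
    unfolding smooth_in_frame_def
    by (rule exI[of _ "\<lambda>i p. 0"]) (simp add: smooth_fun_on_const)
  then show "0 \<in> sections E"
    using assms(1) by (auto simp: sections_def vector_bundle_def subspace_0)
  show "X - Y \<in> sections E" if "X \<in> sections E" "Y \<in> sections E" for X Y
    using section_diff[OF assms(1) that] by (simp add: fun_diff_def)
  show "act E A X \<in> sections E" if "X \<in> sections E" for X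
    using act_section[OF assms that] .
  show "act E A (X + Y) = act E A X + act E A Y" if "X \<in> sections E" "Y \<in> sections E" for X Y
  proof
    fix p
    show "act E A (X + Y) p = (act E A X + act E A Y) p"
      using tensor11_lincomb[OF assms(2) _ section_in_fibre[OF that(1)] section_in_fibre[OF that(2)],
          of p 1 1]
      by (auto simp: act_def)
  qed
qed

section \<open>Translation between structures on \<open>E\<close> and abstract brackets\<close>

lemma dorfman_deform: "dorfman (deform E A \<Theta>) = deformed (act E A) (dorfman \<Theta>)"
  by (auto simp: deform_def deformed_def fun_eq_iff)

text \<open>The equality holds for all arguments, not just sections, so the abstract results on
  iterates transfer by rewriting.\<close>

lemma dorfman_deform_iter:
  "dorfman (deform_iter E A \<Theta> k) = (deformed (act E A) ^^ k) (dorfman \<Theta>)"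
  by (induction k) (simp_all add: dorfman_deform)

text \<open>Bilinearity is given at points of the manifold; since sections vanish elsewhere, with
  coefficients 1 it becomes additivity of total functions.\<close>

lemma pre_courant_biadditive:
  assumes E: "vector_bundle E" and \<Theta>: "pre_courant E g \<Theta>"
  shows "biadditive_on (sections E) (dorfman \<Theta>)"
proof -
  have br: "dorfman \<Theta> X Y \<in> sections E" if "X \<in> sections E" "Y \<in> sections E" for X Y
    using \<Theta> that unfolding pre_courant_def by blast
  have lin: "dorfman \<Theta> (\<lambda>q. 1 *\<^sub>R X q + 1 *\<^sub>R Y q) Z p
          = 1 *\<^sub>R dorfman \<Theta> X Z p + 1 *\<^sub>R dorfman \<Theta> Y Z p"
        "dorfman \<Theta> Z (\<lambda>q. 1 *\<^sub>R X q + 1 *\<^sub>R Y q) p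
          = 1 *\<^sub>R dorfman \<Theta> Z X p + 1 *\<^sub>R dorfman \<Theta> Z Y p"
    if "X \<in> sections E" "Y \<in> sections E" "Z \<in> sections E" "p \<in> points (base E)" for X Y Z p
    using \<Theta> that unfolding pre_courant_def by blast+
  have "dorfman \<Theta> (X + Y) Z = dorfman \<Theta> X Z + dorfman \<Theta> Y Z"
      "dorfman \<Theta> Z (X + Y) = dorfman \<Theta> Z X + dorfman \<Theta> Z Y"
    if "X \<in> sections E" "Y \<in> sections E" "Z \<in> sections E" for X Y Z
    using lin[OF that] that
    by (auto intro!: section_eqI[of _ E] br section_add[OF E] simp: plus_fun_def)
  then show ?thesis using br by (simp add: biadditive_on_def)
qed

theorem theorem2p7:
  fixes E :: "('m, 'v::real_vector) vbundle"
    and g :: "'m \<Rightarrow> 'v \<Rightarrow> 'v \<Rightarrow> real"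
    and \<Theta> :: "('m, 'v) anchored_bracket"
    and I :: "'m \<Rightarrow> 'v \<Rightarrow> 'v"
  assumes "courant_algebroid E g \<Theta>"
    and "tensor11 E I"
    and "skew_symmetric E g I"
    and "nijenhuis E \<Theta> I"
  shows "(\<forall>k m. compatible E g (deform_iter E I \<Theta> k) (deform_iter E I \<Theta> m)) \<and>
         (\<forall>k. compatible E g \<Theta> (deform_iter E I \<Theta> k))"
proof -
  have E: "vector_bundle E" and g: "fibre_form E g" and \<Theta>: "courant E g \<Theta>"
    using assms(1) by (simp_all add: courant_algebroid_def)
  interpret additive_endo "sections E" "act E I"
    using additive_endo_act[OF E assms(2)] .
  let ?T = "\<lambda>k. deform_iter E I \<Theta> k"
  have pre: "pre_courant E g (?T k)" for k
  proof (induction k)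
    case 0
    show ?case using \<Theta> unfolding courant_def by simp
  next
    case (Suc k)
    show ?case using pre_courant_deform[OF E g assms(2,3) Suc.IH] by simp
  qed
  have bi: "biadditive_on (sections E) (dorfman (?T k))" for k
    using pre_courant_biadditive[OF E pre] .
  have courantI: "courant E g \<Psi>"
    if "pre_courant E g \<Psi>" "\<And>X Y Z. X \<in> sections E \<Longrightarrow> Y \<in> sections E \<Longrightarrow> Z \<in> sections E \<Longrightarrow>
      leibnizator (dorfman \<Psi>) (dorfman \<Psi>) X Y Z = 0" for \<Psi>
    unfolding courant_def
  proof (intro conjI ballI that(1))
    fix X Y Z p assume "X \<in> sections E" "Y \<in> sections E" "Z \<in> sections E"
    then have "leibnizator (dorfman \<Psi>) (dorfman \<Psi>) X Y Z p = 0" using that(2) by simp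
    then show "dorfman \<Psi> X (dorfman \<Psi> Y Z) p
        = dorfman \<Psi> (dorfman \<Psi> X Y) Z p + dorfman \<Psi> Y (dorfman \<Psi> X Z) p"
      by (simp add: leibnizator_def diff_diff_eq)
  qed
  \<comment> \<open>The axiom speaks of points of the manifold; the defect is itself a section, so
    it is 0 elsewhere too.\<close>
  have "leibnizator (dorfman \<Theta>) (dorfman \<Theta>) X Y Z = 0"
    if "X \<in> sections E" "Y \<in> sections E" "Z \<in> sections E" for X Y Z
  proof (rule section_eqI[of _ E])
    show "leibnizator (dorfman \<Theta>) (dorfman \<Theta>) X Y Z \<in> sections E"
      using leibnizator_closed[OF bi[of 0] bi[of 0]] that by simp
    fix p assume "p \<in> points (base E)"
    then have "dorfman \<Theta> X (dorfman \<Theta> Y Z) p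
        = dorfman \<Theta> (dorfman \<Theta> X Y) Z p + dorfman \<Theta> Y (dorfman \<Theta> X Z) p"
      using \<Theta> that unfolding courant_def by blast
    then show "leibnizator (dorfman \<Theta>) (dorfman \<Theta>) X Y Z p = 0 p"
      by (simp add: leibnizator_def)
  qed (rule zero)
  then have leib: "leibniz (dorfman \<Theta>)"
    using bi[of 0] by (simp add: leibniz_def)
  \<comment> \<open>The pointwise Nijenhuis condition becomes an equality of sections;
    \<open>bi[of 1]\<close> shows that the deformed bracket is a section.\<close>
  have "dorfman \<Theta> (act E I X) (act E I Y) = act E I (deformed (act E I) (dorfman \<Theta>) X Y)"
    if "X \<in> sections E" "Y \<in> sections E" for X Y
    using that assms(4) bi[of 0] bi[of 1]
    by (intro section_eqI[of _ E])
      (auto simp: nijenhuis_def dorfman_deform T_closed biadditive_on_rules(1))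
  then have "torsion_free (dorfman \<Theta>)" by (simp add: torsion_free_def)
  note iter = cross_leibniz_iterated[OF leib this, folded dorfman_deform_iter]
  have "courant E g (?T k)" for k
    using courantI[OF pre] iter(1)[of k] by (simp add: leibniz_def)
  moreover have "courant E g (structure_sum (?T k) (?T m))" for k m
  proof (rule courantI[OF pre_courant_sum[OF E g pre pre]])
    fix X Y Z assume XYZ: "X \<in> sections E" "Y \<in> sections E" "Z \<in> sections E"
    have "dorfman (structure_sum (?T k) (?T m)) = (\<lambda>X Y. dorfman (?T k) X Y + dorfman (?T m) X Y)"
      by (auto simp: structure_sum_def fun_eq_iff)
    then show "leibnizator (dorfman (structure_sum (?T k) (?T m)))
        (dorfman (structure_sum (?T k) (?T m))) X Y Z = 0"
      using leibnizator_sum[OF bi bi XYZ] iter(1)[of k] iter(1)[of m] iter(2)[of k m] XYZ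
      by (simp add: leibniz_def cross_leibniz_def)
  qed
  ultimately have "compatible E g (?T k) (?T m)" for k m
    by (simp add: compatible_def)
  \<comment> \<open>Index 0 is \<open>\<Theta>\<close> itself, which gives the second
    conjunct.\<close>
  from this this[of 0] show ?thesis by simp
qed

end
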